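(* Let $n\ge1$, $B\in\mathcal{M}_{n\times n}(\mathbb{R})$, and let $(X,d)$ be a complete vector $B$-metric space with $X$ nonempty such that the $B$-metric $d$ is continuous. Let $f\colon X\to\mathbb{R}^n$ be a lower semicontinuous function bounded from below such that for every nonempty closed subset $F\subset X$ and every $\varepsilon>0$ there exists a point $x_{\varepsilon,F}\in F$ with $$f(x_{\varepsilon,F})\le f(x)+\varepsilon e\quad\text{for all }x\in F,$$ where $e=(1,1,\ldots,1)\in\mathbb{R}^n$. Assume that for an operator $N\colon X\to X$ the following conditions are satisfied: $$d(N(x),y)\le d(x,y)+B\,d(N(x),x),\qquad x,y\in X,$$ and $$B\,d(N(x),x)\le f(x)-f(N(x)),\qquad x\in X.$$ Then $N$ has at least one fixed point.
   Context: Vectors in $\mathbb{R}^n$ are columns; inequalities between vectors and convergence of sequences of vectors are understood componentwise. For a set $X$ and an arbitrary matrix $B\in\mathcal{M}_{n\times n}(\mathbb{R})$, a vector $B$-metric on $X$ is a mapping $d\colon X\times X\to\mathbb{R}^n_+$ ($\mathbb{R}_+=[0,\infty)$) such that for all $u,v,w\in X$: $d(u,v)=0$ if and only if $u=v$; $d(u,v)=d(v,u)$; and $d(u,w)\le B\,(d(u,v)+d(v,w))$. Then $(X,d)$ is called a vector $B$-metric space. A sequence $(x_k)$ converges to $x$ (written $x_k\to x$) if $d(x_k,x)\to 0$; it is Cauchy if $d(x_k,x_p)\to0$ as $k,p\to\infty$; $(X,d)$ is complete if every Cauchy sequence converges to a point of $X$. Topological notions are sequential: a subset $F$ is closed if it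 contains the limit of every convergent sequence of its points; $d$ is continuous if $x_k\to x$ and $y_k\to y$ imply $d(x_k,y_k)\to d(x,y)$; $f=(f_1,\ldots,f_n)$ is lower semicontinuous if for each $i$, $x_k\to x$ implies $f_i(x)\le\liminf_{k\to\infty} f_i(x_k)$; $f$ is bounded from below if each $f_i$ is bounded from below. *)

theory Defs
  imports "HOL-Analysis.Analysis"
begin

text \<open>
  The order \<open>\<le>\<close> on \<^typ>\<open>real ^ 'n\<close> is the componentwise one, and its topology is that of
  componentwise convergence. The matrix \<open>B\<close> is arbitrary; its entries may be negative. All notions
  below are relative to a carrier set \<open>X\<close>, and values of \<open>d\<close> and \<open>f\<close> outside \<open>X\<close> are irrelevant.
\<close>

locale vector_B_metric_space =
  fixes B :: "real ^ 'n ^ 'n"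
    and X :: "'a set"
    and d :: "'a \<Rightarrow> 'a \<Rightarrow> real ^ 'n"
  assumes nonneg: "\<And>u v. u \<in> X \<Longrightarrow> v \<in> X \<Longrightarrow> 0 \<le> d u v"
    and zero_iff: "\<And>u v. u \<in> X \<Longrightarrow> v \<in> X \<Longrightarrow> d u v = 0 \<longleftrightarrow> u = v"
    and commute: "\<And>u v. u \<in> X \<Longrightarrow> v \<in> X \<Longrightarrow> d u v = d v u"
    and triangle: "\<And>u v w. u \<in> X \<Longrightarrow> v \<in> X \<Longrightarrow> w \<in> X \<Longrightarrow> d u w \<le> B *v (d u v + d v w)"

definition vconverges :: "('a \<Rightarrow> 'a \<Rightarrow> real ^ 'n) \<Rightarrow> (nat \<Rightarrow> 'a) \<Rightarrow> 'a \<Rightarrow> bool" where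
  "vconverges d s x \<longleftrightarrow> (\<lambda>k. d (s k) x) \<longlonglongrightarrow> 0"

definition vCauchy :: "('a \<Rightarrow> 'a \<Rightarrow> real ^ 'n) \<Rightarrow> (nat \<Rightarrow> 'a) \<Rightarrow> bool" where
  "vCauchy d s \<longleftrightarrow> ((\<lambda>(k, p). d (s k) (s p)) \<longlongrightarrow> 0) (sequentially \<times>\<^sub>F sequentially)"

definition vcomplete :: "'a set \<Rightarrow> ('a \<Rightarrow> 'a \<Rightarrow> real ^ 'n) \<Rightarrow> bool" where
  "vcomplete X d \<longleftrightarrow> (\<forall>s. range s \<subseteq> X \<and> vCauchy d s \<longrightarrow> (\<exists>x\<in>X. vconverges d s x))"

definition vclosed :: "'a set \<Rightarrow> ('a \<Rightarrow> 'a \<Rightarrow> real ^ 'n) \<Rightarrow> 'a set \<Rightarrow> bool" where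
  "vclosed X d F \<longleftrightarrow>
     F \<subseteq> X \<and> (\<forall>s. \<forall>x\<in>X. range s \<subseteq> F \<and> vconverges d s x \<longrightarrow> x \<in> F)"

definition vmetric_continuous :: "'a set \<Rightarrow> ('a \<Rightarrow> 'a \<Rightarrow> real ^ 'n) \<Rightarrow> bool" where
  "vmetric_continuous X d \<longleftrightarrow>
     (\<forall>s t. \<forall>x\<in>X. \<forall>y\<in>X. range s \<subseteq> X \<and> range t \<subseteq> X \<and> vconverges d s x \<and> vconverges d t y
        \<longrightarrow> (\<lambda>k. d (s k) (t k)) \<longlonglongrightarrow> d x y)"

text \<open>The limit inferior is taken in the extended reals.\<close>

definition vlower_semicontinuous ::
  "'a set \<Rightarrow> ('a \<Rightarrow> 'a \<Rightarrow> real ^ 'n) \<Rightarrow> ('a \<Rightarrow> real ^ 'n) \<Rightarrow> bool" where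
  "vlower_semicontinuous X d f \<longleftrightarrow>
     (\<forall>i s. \<forall>x\<in>X. range s \<subseteq> X \<and> vconverges d s x
        \<longrightarrow> ereal (f x $ i) \<le> liminf (\<lambda>k. ereal (f (s k) $ i)))"

definition vbounded_below :: "'a set \<Rightarrow> ('a \<Rightarrow> real ^ 'n) \<Rightarrow> bool" where
  "vbounded_below X f \<longleftrightarrow> (\<forall>i. bdd_below ((\<lambda>x. f x $ i) ` X))"

end

theory Submission
  imports Defs
begin

text \<open>
  The argument is Ekeland's variational principle adapted to a map that respects its construction.
  Fix \<open>z\<close> and a vector \<open>c\<close>. The two conditions on \<open>N\<close> add up to
  \<open>f (N x) + d (N x) z \<le> f x + d x z\<close>, so \<open>N\<close> maps every set \<open>{y. f y + d y z \<le> c}\<close> into itself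
  (\<open>sublevel_invariant\<close>), while lower semicontinuity of \<open>f\<close> and continuity of \<open>d\<close> make such a set
  closed (\<open>vclosed_sublevel\<close>).

  Now shrink \<open>X\<close> repeatedly. Given a nonempty closed invariant set \<open>C\<^sub>k\<close>, choose an \<open>\<epsilon>\<^sub>k\<close>-minimizer
  \<open>z\<^sub>k\<close> of \<open>f\<close> on it and let \<open>C\<^sub>k\<^sub>+\<^sub>1 = {y \<in> C\<^sub>k. f y + d y z\<^sub>k \<le> f z\<^sub>k}\<close>. This set contains \<open>z\<^sub>k\<close>, is
  again closed and invariant, and is small: for its points
  \<open>d y z\<^sub>k \<le> f z\<^sub>k - f y \<le> \<epsilon>\<^sub>k e\<close>, where \<open>e = (1, \<dots>, 1)\<close>. With \<open>\<epsilon>\<^sub>k \<rightarrow> 0\<close>, a version of Cantor's intersection theorem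
  (\<open>cantor_intersection\<close>) shows that the intersection of all \<open>C\<^sub>k\<close> is a single point. The
  intersection is also invariant under \<open>N\<close>, so that point is fixed.
\<close>

lemma tendsto_0_vec_sandwich:
  fixes g h :: "'b \<Rightarrow> real ^ 'n"
  assumes "\<And>t. 0 \<le> g t" and "\<And>t. g t \<le> h t" and "(h \<longlongrightarrow> 0) F"
  shows "(g \<longlongrightarrow> 0) F"
proof (rule Lim_transform_bound[OF _ assms(3)])
  have "norm (g t) \<le> norm (h t)" for t
  proof (rule norm_le_componentwise_cart)
    fix i
    have "0 \<le> g t $ i" "g t $ i \<le> h t $ i"
      using assms(1)[of t] assms(2)[of t] by (simp_all add: less_eq_vec_def)
    then show "norm (g t $ i) \<le> norm (h t $ i)" by simp
  qed
  then show "\<forall>\<^sub>F t in F. norm (g t) \<le> norm (h t)" by simp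
qed

text \<open>
  Pairing the sequence with itself, continuity of \<open>d\<close> turns the constant value \<open>0\<close> of
  \<open>d (s k) (s k)\<close> into \<open>d x y = 0\<close>.
\<close>

lemma vconverges_unique:
  assumes "vector_B_metric_space B X d" and "vmetric_continuous X d"
    and "range s \<subseteq> X" and "x \<in> X" and "y \<in> X"
    and "vconverges d s x" and "vconverges d s y"
  shows "x = y"
proof -
  interpret vector_B_metric_space B X d by fact
  have "(\<lambda>k. d (s k) (s k)) \<longlonglongrightarrow> d x y"
    using assms unfolding vmetric_continuous_def by blast
  moreover have "d (s k) (s k) = 0" for k
    using assms(3) by (simp add: zero_iff range_subsetD)
  ultimately have "d x y = 0" by (simp add: LIMSEQ_const_iff)
  then show ?thesis using assms(4,5) by (simp add: zero_iff)
qed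

lemma vclosed_sublevel:
  assumes "vector_B_metric_space B X d" and cont: "vmetric_continuous X d"
    and lsc: "vlower_semicontinuous X d f" and z: "z \<in> X"
  shows "vclosed X d {y \<in> X. f y + d y z \<le> c}"
  unfolding vclosed_def
proof (intro conjI allI ballI impI)
  interpret vector_B_metric_space B X d by fact
  fix s x
  assume x: "x \<in> X" and "range s \<subseteq> {y \<in> X. f y + d y z \<le> c} \<and> vconverges d s x"
  then have s: "range s \<subseteq> X" and le: "\<And>k. f (s k) + d (s k) z \<le> c" and lim: "vconverges d s x"
    by auto
  have "vconverges d (\<lambda>_. z) z"
    using z zero_iff[of z z] by (simp add: vconverges_def)
  then have dlim: "(\<lambda>k. d (s k) z) \<longlonglongrightarrow> d x z"
    using cont[unfolded vmetric_continuous_def, rule_format, of x z s "\<lambda>_. z"] x z s lim by auto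
  have "f x $ i + d x z $ i \<le> c $ i" for i
  proof -
    have "(\<lambda>k. ereal (c $ i - d (s k) z $ i)) \<longlonglongrightarrow> ereal (c $ i - d x z $ i)"
      by (intro tendsto_intros dlim)
    then have lim_bound: "liminf (\<lambda>k. ereal (c $ i - d (s k) z $ i)) = ereal (c $ i - d x z $ i)"
      by (intro lim_imp_Liminf) auto
    have "ereal (f x $ i) \<le> liminf (\<lambda>k. ereal (f (s k) $ i))"
      using lsc x s lim unfolding vlower_semicontinuous_def by blast
    also have "\<dots> \<le> liminf (\<lambda>k. ereal (c $ i - d (s k) z $ i))"
      using le by (intro Liminf_mono) (simp add: less_eq_vec_def le_diff_eq)
    finally show ?thesis by (simp add: lim_bound)
  qed
  then show "x \<in> {y \<in> X. f y + d y z \<le> c}"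
    using x by (simp add: less_eq_vec_def)
qed auto

lemma vclosed_Int:
  assumes "vclosed X d F" and "vclosed X d G"
  shows "vclosed X d (F \<inter> G)"
  using assms unfolding vclosed_def by blast

text \<open>
  The displacement bound makes up for the growth of the distance to \<open>z\<close>: what \<open>d\<close> gains in passing
  from \<open>x\<close> to \<open>N x\<close> is at most what \<open>f\<close> loses.
\<close>

lemma sublevel_invariant:
  fixes f :: "'a \<Rightarrow> real ^ 'n"
  assumes "d (N x) z \<le> d x z + B *v d (N x) x"
    and "B *v d (N x) x \<le> f x - f (N x)"
    and "f x + d x z \<le> c"
  shows "f (N x) + d (N x) z \<le> c"
proof -
  have "f (N x) + d (N x) z \<le> f (N x) + (d x z + (f x - f (N x)))"
    using assms(1,2) by (meson add_left_mono order_trans)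
  also have "\<dots> = f x + d x z" by simp
  finally show ?thesis using assms(3) by (rule order_trans)
qed

text \<open>
  Smallness is measured from the distinguished points \<open>z k\<close> only, because the diameter of a ball
  is controlled through \<open>B\<close> and would bring in its entries. This suffices: \<open>z p\<close> lies in \<open>C (Suc k)\<close>
  for \<open>p > k\<close>, which makes \<open>z\<close> Cauchy, and \<open>z\<close> converges to every point of the intersection.
\<close>

lemma cantor_intersection:
  fixes r :: "nat \<Rightarrow> real ^ 'n"
  assumes "vector_B_metric_space B X d" and cont: "vmetric_continuous X d"
    and complete: "vcomplete X d"
    and closed: "\<And>k. vclosed X d (C k)" and "decseq C"
    and z: "\<And>k. z k \<in> C k"
    and small: "\<And>k y. y \<in> C (Suc k) \<Longrightarrow> d y (z k) \<le> r k"
    and r: "r \<longlonglongrightarrow> 0"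
  shows "\<exists>x\<in>X. (\<Inter>k. C k) = {x}"
proof -
  interpret vector_B_metric_space B X d by fact
  have CX: "C k \<subseteq> X" for k using closed by (simp add: vclosed_def)
  then have zX: "z k \<in> X" for k using z by blast
  have zC: "z p \<in> C k" if "k \<le> p" for k p
    using z[of p] decseqD[OF \<open>decseq C\<close> that] by blast
  have r0: "0 \<le> r k" for k
    using nonneg[OF zX zX] small[OF zC[of "Suc k" "Suc k"]] by (meson order_refl order_trans)
  have dist_less: "d (z p) (z k) \<le> r k + r p" if "k < p" for k p
    using small[OF zC[of "Suc k" p]] that r0[of p] by (meson Suc_leI add_increasing2)
  have dist: "d (z k) (z p) \<le> r k + r p" for k p
  proof (cases k p rule: linorder_cases)
    case less
    then show ?thesis using dist_less[of k p] commute[OF zX zX, of k p] by simp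
  next
    case equal
    then show ?thesis using zero_iff[OF zX zX, of k p] add_nonneg_nonneg[OF r0 r0, of k p] by simp
  next
    case greater
    then show ?thesis using dist_less[of p k] by (simp add: add.commute)
  qed
  have "((\<lambda>t. r (fst t) + r (snd t)) \<longlongrightarrow> 0 + 0) (sequentially \<times>\<^sub>F sequentially)"
    by (rule tendsto_add[OF filterlim_compose[OF r filterlim_fst]
          filterlim_compose[OF r filterlim_snd]])
  then have sum: "((\<lambda>t. r (fst t) + r (snd t)) \<longlongrightarrow> 0) (sequentially \<times>\<^sub>F sequentially)"
    by simp
  have "((\<lambda>t. d (z (fst t)) (z (snd t))) \<longlongrightarrow> 0) (sequentially \<times>\<^sub>F sequentially)"
    using nonneg[OF zX zX] dist by (rule tendsto_0_vec_sandwich[OF _ _ sum])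
  then have "vCauchy d z" by (simp add: vCauchy_def case_prod_unfold)
  then obtain x where x: "x \<in> X" and lim: "vconverges d z x"
    using complete zX unfolding vcomplete_def by blast
  have "x \<in> C k" for k
  proof -
    \<comment> \<open>Only the tail from index \<open>k\<close> on stays in \<open>C k\<close>.\<close>
    have "vconverges d (\<lambda>p. z (p + k)) x"
      using LIMSEQ_ignore_initial_segment lim unfolding vconverges_def by blast
    moreover have "range (\<lambda>p. z (p + k)) \<subseteq> C k" using zC by auto
    ultimately show ?thesis using closed[of k] x unfolding vclosed_def by blast
  qed
  moreover have "y = x" if y: "\<And>k. y \<in> C k" for y
  proof -
    have yX: "y \<in> X" using CX y by blast
    have "d (z k) y \<le> r k" for k
      using small[OF y] commute[OF zX yX] by simp
    then have "(\<lambda>k. d (z k) y) \<longlonglongrightarrow> 0"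
      using nonneg[OF zX yX] by (intro tendsto_0_vec_sandwich[OF _ _ r])
    then show ?thesis
      using vconverges_unique[OF assms(1) cont _ yX x, of z] zX lim
      by (auto simp: vconverges_def)
  qed
  ultimately have "(\<Inter>k. C k) = {x}" by (intro set_eqI iffI) auto
  then show ?thesis using x by blast
qed

theorem theorem4p8:
  fixes B :: "real ^ 'n ^ 'n"
    and X :: "'a set"
    and d :: "'a \<Rightarrow> 'a \<Rightarrow> real ^ 'n"
    and f :: "'a \<Rightarrow> real ^ 'n"
    and N :: "'a \<Rightarrow> 'a"
  assumes "vector_B_metric_space B X d"
    and "vcomplete X d"
    and "X \<noteq> {}"
    and "vmetric_continuous X d"
    and "vlower_semicontinuous X d f"
    and "vbounded_below X f"
    and "\<And>F \<epsilon>. vclosed X d F \<Longrightarrow> F \<noteq> {} \<Longrightarrow> (0::real) < \<epsilon> \<Longrightarrow>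
           \<exists>z\<in>F. \<forall>x\<in>F. f z \<le> f x + \<epsilon> *\<^sub>R (\<chi> i. 1)"
    and "N \<in> X \<rightarrow> X"
    and "\<And>x y. x \<in> X \<Longrightarrow> y \<in> X \<Longrightarrow> d (N x) y \<le> d x y + B *v d (N x) x"
    and "\<And>x. x \<in> X \<Longrightarrow> B *v d (N x) x \<le> f x - f (N x)"
  shows "\<exists>x\<in>X. N x = x"
proof -
  interpret vector_B_metric_space B X d by fact
  define \<epsilon> :: "nat \<Rightarrow> real" where "\<epsilon> k = inverse (real (Suc k))" for k
  define e :: "real ^ 'n" where "e = (\<chi> i. 1)"
  have \<epsilon>_pos: "0 < \<epsilon> k" for k by (simp add: \<epsilon>_def)
  \<comment> \<open>Fixing one minimizer for each set and tolerance lets the sets be defined by primitive recursion.\<close>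
  define m where "m F \<delta> = (SOME z. z \<in> F \<and> (\<forall>x\<in>F. f z \<le> f x + \<delta> *\<^sub>R e))" for F \<delta>
  have m: "m F \<delta> \<in> F \<and> (\<forall>x\<in>F. f (m F \<delta>) \<le> f x + \<delta> *\<^sub>R e)"
    if "vclosed X d F" "F \<noteq> {}" "0 < \<delta>" for F \<delta>
  proof -
    have "\<exists>z. z \<in> F \<and> (\<forall>x\<in>F. f z \<le> f x + \<delta> *\<^sub>R e)"
      using assms(7)[OF that] unfolding e_def by blast
    from someI_ex[OF this] show ?thesis unfolding m_def .
  qed
  define C where
    "C = rec_nat X (\<lambda>k F. F \<inter> {y \<in> X. f y + d y (m F (\<epsilon> k)) \<le> f (m F (\<epsilon> k))})"
  define z where "z k = m (C k) (\<epsilon> k)" for k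
  have C_0: "C 0 = X"
    and C_Suc: "C (Suc k) = C k \<inter> {y \<in> X. f y + d y (z k) \<le> f (z k)}" for k
    by (simp_all add: C_def z_def)
  have C: "vclosed X d (C k) \<and> C k \<noteq> {} \<and> N ` C k \<subseteq> C k" for k
  proof (induction k)
    case 0
    show ?case using \<open>X \<noteq> {}\<close> \<open>N \<in> X \<rightarrow> X\<close> by (auto simp: C_0 vclosed_def)
  next
    case (Suc k)
    then have zk: "z k \<in> C k" using m[of "C k" "\<epsilon> k"] \<epsilon>_pos by (simp add: z_def)
    then have zkX: "z k \<in> X" using Suc by (auto simp: vclosed_def)
    then have "z k \<in> C (Suc k)" using zk zero_iff[of "z k" "z k"] by (simp add: C_Suc)
    moreover have "vclosed X d (C (Suc k))"
      unfolding C_Suc using Suc vclosed_sublevel[OF assms(1,4,5) zkX] by (intro vclosed_Int) auto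
    moreover have "N x \<in> C (Suc k)" if "x \<in> C (Suc k)" for x
    proof -
      have x: "x \<in> C k" "x \<in> X" "f x + d x (z k) \<le> f (z k)" using that by (auto simp: C_Suc)
      then have "f (N x) + d (N x) (z k) \<le> f (z k)"
        using assms(9,10) zkX by (intro sublevel_invariant[where d = d and N = N and B = B]) auto
      then show ?thesis using x Suc \<open>N \<in> X \<rightarrow> X\<close> by (auto simp: C_Suc)
    qed
    ultimately show ?case by blast
  qed
  have "\<exists>x\<in>X. (\<Inter>k. C k) = {x}"
  proof (rule cantor_intersection[OF assms(1,4,2), where z = z and r = "\<lambda>k. \<epsilon> k *\<^sub>R e"])
    show "decseq C" by (rule decseq_SucI) (auto simp: C_Suc)
    show "z k \<in> C k" for k using C m[of "C k" "\<epsilon> k"] \<epsilon>_pos by (simp add: z_def)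
    show "d y (z k) \<le> \<epsilon> k *\<^sub>R e" if "y \<in> C (Suc k)" for k y
    proof -
      have "f y + d y (z k) \<le> f (z k)" using that by (simp add: C_Suc)
      also have "\<dots> \<le> f y + \<epsilon> k *\<^sub>R e"
        using m[of "C k" "\<epsilon> k"] C \<epsilon>_pos that by (simp add: z_def C_Suc)
      finally show ?thesis by simp
    qed
    have "\<epsilon> \<longlonglongrightarrow> 0" unfolding \<epsilon>_def by (rule LIMSEQ_inverse_real_of_nat)
    then show "(\<lambda>k. \<epsilon> k *\<^sub>R e) \<longlonglongrightarrow> 0"
      using tendsto_scaleR[OF _ tendsto_const, of \<epsilon> 0 sequentially e] by simp
  qed (use C in blast)
  then obtain x where x: "x \<in> X" and inter: "(\<Inter>k. C k) = {x}" by blast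
  have "N x \<in> (\<Inter>k. C k)" using C inter by blast
  then show ?thesis using x inter by blast
qed

end
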